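(* Let $P \subseteq \mathbb{R}^d$ be a polytope (with arbitrary real vertices) which is either full-dimensional or has codimension $1$ (i.e. $\dim P \in \{d, d-1\}$). Then there is an integer vector $w \in \mathbb{Z}^d$ such that the functions $s \mapsto L_{P + kw}(s)$, for integers $k \ge 0$, are pairwise distinct.
   Context: For a polytope $P \subseteq \mathbb{R}^d$ and real $s \ge 0$, the real Ehrhart function is $L_P(s) = \#(sP \cap \mathbb{Z}^d)$, where $sP = \{sx : x \in P\}$. *)

theory Defs
  imports "HOL-Analysis.Analysis"
begin

definition int_vec :: "real^'n \<Rightarrow> bool" where
  "int_vec z \<longleftrightarrow> (\<forall>i. z $ i \<in> \<int>)"

definition ehrhart :: "(real^'n) set \<Rightarrow> real \<Rightarrow> nat" where
  "ehrhart P s = card {z. int_vec z \<and> z \<in> (\<lambda>x. s *\<^sub>R x) ` P}"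

end

theory Submission
  imports Defs
begin

text \<open>
  If some real multiple \<open>t u\<close> of a nonzero integer vector \<open>u\<close>, taken primitive, lies in \<open>P\<close>, translate by
  \<open>w = m u\<close> with \<open>m\<close> large. Then \<open>s = 1 / (k' m + t)\<close> is the time at which \<open>u\<close> enters
  \<open>s (P + k' w)\<close>, while for \<open>k < k'\<close> all points of \<open>s (P + k w)\<close> are so close to the segment from \<open>0\<close>
  to \<open>u\<close> that none of them is an integer point (unless \<open>k = 0\<close> and \<open>0 \<in> P\<close>, which is told apart by
  small \<open>s\<close>).

  By density of rational directions, the only other possibility is that \<open>P\<close> spans a linear
  hyperplane \<open>a \<bullet> x = 0\<close>. Normalise \<open>a $ j = 1\<close> and translate by \<open>w = m e\<^sub>j\<close>. Projecting along \<open>e\<^sub>j\<close>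
  turns the integer points of all \<open>s (P + k w)\<close>, \<open>s \<le> X\<close>, into finitely many lattice points of the
  hyperplane; over each of them the admissible \<open>s\<close> form an arithmetic progression with step
  \<open>1 / (k m)\<close> in a fixed compact interval. Hence the total count is \<open>k m\<close> times the total length of
  the intervals up to a bounded error, so it is strictly increasing in \<open>k\<close> once \<open>m\<close> is large.
\<close>

section \<open>Integer vectors and vanishing of the count\<close>

lemma int_vec_diff: "int_vec x \<Longrightarrow> int_vec y \<Longrightarrow> int_vec (x - y)"
  by (simp add: int_vec_def)

lemma int_vec_scale: "c \<in> \<int> \<Longrightarrow> int_vec x \<Longrightarrow> int_vec (c *\<^sub>R x)"
  by (simp add: int_vec_def)

lemma int_vec_axis: "int_vec (axis j 1 :: real^'n)"
  by (simp add: int_vec_def axis_def)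

lemma int_vec_norm_ge_1:
  assumes "int_vec x" "x \<noteq> 0"
  shows "norm x \<ge> 1"
proof -
  obtain i where i: "x $ i \<noteq> 0" using assms(2) by (auto simp: vec_eq_iff)
  have "1 \<le> \<bar>x $ i\<bar>" using assms(1) i by (simp add: int_vec_def Ints_nonzero_abs_ge1)
  also have "\<dots> \<le> norm x" by (rule component_le_norm_cart)
  finally show ?thesis .
qed

lemma finite_int_vec_bounded:
  fixes S :: "(real^'n) set"
  assumes "bounded S"
  shows "finite {z. int_vec z \<and> z \<in> S}"
proof -
  obtain B where B: "\<And>x. x \<in> S \<Longrightarrow> norm x \<le> B" using assms by (auto simp: bounded_iff)
  have "finite ((\<lambda>f. \<chi> i. f i) ` (UNIV \<rightarrow>\<^sub>E {x \<in> \<int>. \<bar>x\<bar> \<le> B}) :: (real^'n) set)"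
    by (intro finite_imageI finite_PiE finite finite_abs_int_segment)
  moreover have "{z. int_vec z \<and> z \<in> S} \<subseteq> (\<lambda>f. \<chi> i. f i) ` (UNIV \<rightarrow>\<^sub>E {x \<in> \<int>. \<bar>x\<bar> \<le> B})"
  proof safe
    fix z assume z: "int_vec z" "z \<in> S"
    have "\<bar>z $ i\<bar> \<le> B" for i using component_le_norm_cart[of z i] B[OF z(2)] by linarith
    then show "z \<in> (\<lambda>f. \<chi> i. f i) ` (UNIV \<rightarrow>\<^sub>E {x \<in> \<int>. \<bar>x\<bar> \<le> B})"
      using z(1) by (intro image_eqI[where x="\<lambda>i. z $ i"]) (auto simp: int_vec_def)
  qed
  ultimately show ?thesis by (rule rev_finite_subset)
qed

lemma finite_ehrhart_points:
  assumes "bounded P"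
  shows "finite {z. int_vec z \<and> z \<in> (\<lambda>x. s *\<^sub>R x) ` P}"
  by (intro finite_int_vec_bounded bounded_scaling assms)

text \<open>Boundedness matters here because \<open>card\<close> is also 0 on infinite sets.\<close>

lemma ehrhart_eq_0_iff:
  assumes "bounded P"
  shows "ehrhart P s = 0 \<longleftrightarrow> (\<forall>p\<in>P. \<not> int_vec (s *\<^sub>R p))"
  using finite_ehrhart_points[OF assms, of s] by (auto simp: ehrhart_def)

lemma ehrhart_translate_eq_0_iff:
  assumes "bounded P"
  shows "ehrhart ((\<lambda>x. x + v) ` P) s = 0 \<longleftrightarrow> (\<forall>p\<in>P. \<not> int_vec (s *\<^sub>R (p + v)))"
proof -
  have "bounded ((\<lambda>x. x + v) ` P)"
    using bounded_translation[OF assms, of v] by (simp add: add.commute)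
  from ehrhart_eq_0_iff[OF this] show ?thesis by simp
qed

section \<open>Translates along a rational direction\<close>

text \<open>The shortest nonzero integer vector on the line serves as \<open>u\<close>: if
  \<open>r u\<close> were integral for a non-integer \<open>r\<close>, then \<open>frac r\<close>
  times \<open>u\<close> would be a shorter one.\<close>

lemma primitive_int_vec_on_line:
  fixes w :: "real^'n"
  assumes w: "int_vec w" "w \<noteq> 0"
  obtains u c where "int_vec u" "u \<noteq> 0" "w = c *\<^sub>R u" "\<And>r. int_vec (r *\<^sub>R u) \<Longrightarrow> r \<in> \<int>"
proof -
  obtain i where i: "w $ i \<noteq> 0" using w(2) by (auto simp: vec_eq_iff)
  \<comment> \<open>The index \<open>n\<close> is the absolute value of the \<open>i\<close>-th
    coordinate of the multiple, so integral multiples are numbered by naturals and a least one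
    exists.\<close>
  define Q where "Q n \<longleftrightarrow> n > 0 \<and> int_vec ((real n / \<bar>w $ i\<bar>) *\<^sub>R w)" for n
  have "\<bar>w $ i\<bar> \<in> \<int>" using w(1) by (simp add: int_vec_def)
  then obtain n0 where n0: "\<bar>w $ i\<bar> = real n0"
    by (metis Ints_cases abs_ge_zero abs_of_nonneg of_int_0_le_iff of_nat_nat)
  have "Q n0" using n0 i w(1) by (auto simp: Q_def)
  define n where "n = (LEAST n. Q n)"
  have n: "Q n" unfolding n_def by (rule LeastI, rule \<open>Q n0\<close>)
  have least: "Q k \<Longrightarrow> n \<le> k" for k unfolding n_def by (rule Least_le)
  define u where "u = (real n / \<bar>w $ i\<bar>) *\<^sub>R w"
  have npos: "n > 0" using n by (simp add: Q_def)
  have prim: "r \<in> \<int>" if r: "int_vec (r *\<^sub>R u)" for r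
  proof (rule ccontr)
    assume "r \<notin> \<int>"
    then have fr: "frac r > 0" by simp
    have "int_vec (r *\<^sub>R u - of_int \<lfloor>r\<rfloor> *\<^sub>R u)"
      using n r by (intro int_vec_diff int_vec_scale[of "of_int _"]) (simp_all add: Q_def u_def)
    then have iv: "int_vec (frac r *\<^sub>R u)" by (simp add: frac_def scaleR_diff_left)
    then have "\<bar>frac r * u $ i\<bar> \<in> \<int>" by (simp add: int_vec_def)
    moreover have "\<bar>u $ i\<bar> = n" using i by (simp add: u_def abs_mult)
    ultimately have "frac r * n \<in> \<int>" using fr by (simp add: abs_mult)
    then obtain m where m: "frac r * n = real m"
      by (metis Ints_cases frac_ge_0 of_int_0_le_iff of_nat_0_le_iff of_nat_nat zero_le_mult_iff)
    have "m > 0" using m fr npos by (metis of_nat_0_less_iff zero_less_mult_pos zero_less_mult_iff)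
    moreover have "(real m / \<bar>w $ i\<bar>) *\<^sub>R w = frac r *\<^sub>R u" by (simp add: u_def m[symmetric])
    ultimately have "Q m" using iv by (simp add: Q_def)
    then have "real n \<le> frac r * n" using least m by simp
    then show False using npos frac_lt_1[of r] by simp
  qed
  show ?thesis
  proof (rule that[OF _ _ _ prim])
    show "int_vec u" using n by (simp add: Q_def u_def)
    show "u \<noteq> 0" using npos i w(2) by (simp add: u_def)
    show "w = (\<bar>w $ i\<bar> / real n) *\<^sub>R u" using npos i by (simp add: u_def)
  qed
qed

lemma separating_translates_rational_direction:
  fixes P :: "(real^'n) set"
  assumes P: "bounded P" and w: "int_vec w" "w \<noteq> 0" and t: "t *\<^sub>R w \<in> P"
  shows "\<exists>w::real^'n. int_vec w \<and>
           (\<forall>k k' :: nat. k < k' \<longrightarrow>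
              (\<exists>s\<ge>0. ehrhart ((\<lambda>x. x + real k *\<^sub>R w) ` P) s
                     \<noteq> ehrhart ((\<lambda>x. x + real k' *\<^sub>R w) ` P) s))"
proof -
  obtain u c where u: "int_vec u" "u \<noteq> 0" and c: "w = c *\<^sub>R u"
    and prim: "\<And>r. int_vec (r *\<^sub>R u) \<Longrightarrow> r \<in> \<int>"
    using primitive_int_vec_on_line[OF w] by metis
  define t' where "t' = t * c"
  have t': "t' *\<^sub>R u \<in> P" using t by (simp add: t'_def c)
  have nu: "norm u \<ge> 1" using u by (rule int_vec_norm_ge_1)
  obtain C where C: "C > 0" "\<And>p. p \<in> P \<Longrightarrow> norm p \<le> C" using P by (auto simp: bounded_pos)
  \<comment> \<open>The summands make \<open>D\<close> below exceed both \<open>k m + C\<close> and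
    \<open>2 C * norm u\<close> whenever \<open>k < k'\<close>, even if \<open>t'\<close> is
    negative.\<close>
  obtain m :: nat where m: "m > \<bar>t'\<bar> + C + 2 * C * norm u" using reals_Archimedean2 by blast
  have Cu: "C * norm u > 0" using C(1) nu by (intro mult_pos_pos) linarith+
  have m0: "m > 0" "real m > C" "real m > C + \<bar>t'\<bar>" using m C(1) Cu by (auto intro: Nat.gr0I)
  have distinct: "\<exists>s\<ge>0. ehrhart ((\<lambda>x. x + real k *\<^sub>R (real m *\<^sub>R u)) ` P) s
                     \<noteq> ehrhart ((\<lambda>x. x + real k' *\<^sub>R (real m *\<^sub>R u)) ` P) s"
    if kk: "k < k'" for k k' :: nat
  proof (cases "k = 0 \<and> 0 \<in> P")
    case True
    \<comment> \<open>This \<open>s\<close> is so small that the dilate of the translate by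
      \<open>k' m u\<close> lies in the open unit ball, where only the origin is integral;
      \<open>m > C\<close> keeps the origin out. The untranslated \<open>P\<close> contains 0 and so
      has a positive count at every \<open>s\<close>.\<close>
    define s where "s = 1 / (1 + C + real k' * real m * norm u)"
    have s: "s > 0" "s * (C + real k' * real m * norm u) < 1"
      unfolding s_def using C(1) by (auto simp: divide_simps add_pos_nonneg intro!: add_pos_nonneg)
    have no: "\<not> int_vec (s *\<^sub>R (p + real k' *\<^sub>R (real m *\<^sub>R u)))" if p: "p \<in> P" for p
    proof
      assume iv: "int_vec (s *\<^sub>R (p + real k' *\<^sub>R (real m *\<^sub>R u)))"
      have "norm (p + real k' *\<^sub>R (real m *\<^sub>R u)) \<le> C + real k' * real m * norm u"
        using norm_triangle_ineq[of p "real k' *\<^sub>R (real m *\<^sub>R u)"] C(2)[OF p]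
        by (simp add: mult.assoc)
      then have "s * norm (p + real k' *\<^sub>R (real m *\<^sub>R u)) \<le> s * (C + real k' * real m * norm u)"
        using s(1) by (intro mult_left_mono) auto
      then have "norm (s *\<^sub>R (p + real k' *\<^sub>R (real m *\<^sub>R u))) < 1"
        using s by (simp only: norm_scaleR abs_of_pos)
      then have "s *\<^sub>R (p + real k' *\<^sub>R (real m *\<^sub>R u)) = 0"
        using int_vec_norm_ge_1[OF iv] by linarith
      then have "p = - (real k' *\<^sub>R (real m *\<^sub>R u))" using s(1) by (simp add: eq_neg_iff_add_eq_0)
      then have "norm p = real k' * real m * norm u" by (simp add: mult.assoc)
      moreover have "1 * real m * 1 \<le> real k' * real m * norm u"
        using kk nu by (intro mult_mono) auto
      ultimately show False using C(2)[OF p] m0 by linarith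
    qed
    have "ehrhart ((\<lambda>x. x + real k' *\<^sub>R (real m *\<^sub>R u)) ` P) s = 0"
      unfolding ehrhart_translate_eq_0_iff[OF P] using no by blast
    moreover have "ehrhart ((\<lambda>x. x + real k *\<^sub>R (real m *\<^sub>R u)) ` P) s \<noteq> 0"
      unfolding ehrhart_translate_eq_0_iff[OF P] using True by (intro notI) (auto simp: int_vec_def)
    ultimately show ?thesis using s(1) by (metis less_imp_le)
  next
    case False
    define D where "D = real k' * real m + t'"
    have k'm: "real k' * real m \<ge> real k * real m + real m"
    proof -
      have "(real k + 1) * m \<le> real k' * real m" using kk by (intro mult_right_mono) auto
      then show ?thesis by (simp add: algebra_simps)
    qed
    have km0: "real k * real m \<ge> 0" by simp
    have D: "D > real k * real m + C" "D > 2 * C * norm u" "D > 0"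
      using k'm m Cu C(1) km0 unfolding D_def by linarith+
    \<comment> \<open>At this \<open>s\<close> the translate of \<open>t' u\<close> is carried
      exactly to \<open>u\<close>.\<close>
    define s where "s = 1 / D"
    have "s *\<^sub>R (t' *\<^sub>R u + real k' *\<^sub>R (real m *\<^sub>R u)) = (s * D) *\<^sub>R u"
      by (simp add: D_def algebra_simps)
    also have "\<dots> = u" using D(3) by (simp add: s_def)
    finally have "int_vec (s *\<^sub>R (t' *\<^sub>R u + real k' *\<^sub>R (real m *\<^sub>R u)))" using u(1) by simp
    then have 1: "ehrhart ((\<lambda>x. x + real k' *\<^sub>R (real m *\<^sub>R u)) ` P) s \<noteq> 0"
      unfolding ehrhart_translate_eq_0_iff[OF P] using t' by blast
    have no: "\<not> int_vec (s *\<^sub>R (p + real k *\<^sub>R (real m *\<^sub>R u)))" if p: "p \<in> P" for p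
    proof
      define z where "z = s *\<^sub>R (p + real k *\<^sub>R (real m *\<^sub>R u))"
      assume "int_vec (s *\<^sub>R (p + real k *\<^sub>R (real m *\<^sub>R u)))"
      then have z: "int_vec z" by (simp add: z_def)
      have spos: "s > 0" using D by (simp add: s_def)
      \<comment> \<open>The multiple of \<open>u\<close> cancels in the 2x2 minors of
        \<open>z\<close> and \<open>u\<close>, so these are integers of absolute value below 1,
        hence 0, and \<open>z\<close> is parallel to \<open>u\<close>.\<close>
      have minor: "z $ i * u $ j = z $ j * u $ i" for i j
      proof -
        have "z $ i * u $ j - z $ j * u $ i = s * (p $ i * u $ j - p $ j * u $ i)"
          by (simp add: z_def algebra_simps)
        then have "\<bar>z $ i * u $ j - z $ j * u $ i\<bar> = s * \<bar>p $ i * u $ j - p $ j * u $ i\<bar>"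
          using spos by (simp add: abs_mult)
        moreover have "\<bar>p $ i * u $ j - p $ j * u $ i\<bar> \<le> 2 * C * norm u"
        proof -
          have *: "\<bar>p $ i * u $ j\<bar> \<le> C * norm u" for i j
            unfolding abs_mult
            using component_le_norm_cart[of p i] component_le_norm_cart[of u j] C(2)[OF p]
            by (intro mult_mono) auto
          show ?thesis using *[of i j] *[of j i] by linarith
        qed
        moreover have "s * (2 * C * norm u) < 1" using D by (simp add: s_def)
        ultimately have "\<bar>z $ i * u $ j - z $ j * u $ i\<bar> < 1"
          using spos mult_left_mono[of "\<bar>p $ i * u $ j - p $ j * u $ i\<bar>" "2 * C * norm u" s]
          by linarith
        moreover have "z $ i * u $ j - z $ j * u $ i \<in> \<int>"
          using z u(1) by (simp add: int_vec_def)
        ultimately have "z $ i * u $ j - z $ j * u $ i = 0" using Ints_nonzero_abs_less1 by blast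
        then show ?thesis by simp
      qed
      obtain i where i: "u $ i \<noteq> 0" using u(2) by (auto simp: vec_eq_iff)
      define r where "r = z $ i / u $ i"
      have zr: "z = r *\<^sub>R u" using minor[of i] i by (auto simp: vec_eq_iff r_def field_simps)
      then have "r \<in> \<int>" using z prim by auto
      \<comment> \<open>Now \<open>p\<close> is parallel to \<open>u\<close> too, with coefficient
        \<open>D r - k m\<close> of absolute value at most \<open>C\<close>. As
        \<open>D > k m + C\<close>, this forces \<open>r = 0\<close>; then
        \<open>k m \<le> C < m\<close> gives \<open>k = 0\<close> and \<open>p = 0\<close>, the
        excluded case.\<close>
      have "s *\<^sub>R p = (r - s * (real k * real m)) *\<^sub>R u"
        using zr by (simp add: z_def algebra_simps)
      then have "D *\<^sub>R (s *\<^sub>R p) = D *\<^sub>R ((r - s * (real k * real m)) *\<^sub>R u)" by (rule arg_cong)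
      moreover have "p = D *\<^sub>R (s *\<^sub>R p)" using D(3) by (simp add: s_def)
      ultimately have "p = D *\<^sub>R ((r - s * (real k * real m)) *\<^sub>R u)" by (rule trans[rotated])
      also have "\<dots> = (D * r - real k * real m) *\<^sub>R u" using D by (simp add: s_def right_diff_distrib)
      finally have p_eq: "p = (D * r - real k * real m) *\<^sub>R u" .
      then have "\<bar>D * r - real k * real m\<bar> * norm u \<le> C" using C(2)[OF p] by simp
      moreover have "\<bar>D * r - real k * real m\<bar> * 1 \<le> \<bar>D * r - real k * real m\<bar> * norm u"
        using nu by (intro mult_left_mono) auto
      ultimately have b: "\<bar>D * r - real k * real m\<bar> \<le> C" by (metis mult_1_right order_trans)
      then have "D * r < D * 1" "D * (-1) < D * r" using D km0 by linarith+
      then have "r < 1" "-1 < r" using D(3) mult_less_cancel_left_pos by blast+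
      then have "\<bar>r\<bar> < 1" by linarith
      then have r0: "r = 0" using \<open>r \<in> \<int>\<close> Ints_nonzero_abs_less1 by blast
      then have "real k * real m \<le> C" using b by simp
      then have "real k * real m < 1 * real m" using m0(2) by linarith
      then have "real k < 1" by (rule mult_right_less_imp_less) simp
      then have "k = 0" by simp
      with False p p_eq r0 show False by simp
    qed
    then have "ehrhart ((\<lambda>x. x + real k *\<^sub>R (real m *\<^sub>R u)) ` P) s = 0"
      unfolding ehrhart_translate_eq_0_iff[OF P] by blast
    then show ?thesis using 1 D(3) by (intro exI[of _ s]) (simp add: s_def)
  qed
  have "int_vec (real m *\<^sub>R u)" using u(1) by (intro int_vec_scale) auto
  then show ?thesis using distinct by blast
qed

section \<open>Counting in fibres, approximation and intervals of dilation factors\<close>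

text \<open>With dilation factors as first components, differing totals reveal a factor at which two
  Ehrhart functions differ.\<close>

lemma card_eq_if_fibres_eq:
  assumes fin: "finite G" "finite H"
    and eq: "\<And>x. card {b. (x, b) \<in> G} = card {b. (x, b) \<in> H}"
  shows "card G = card H"
proof -
  define T where "T = fst ` G \<union> fst ` H"
  have fT: "finite T" using fin by (simp add: T_def)
  have card_fibres: "card K = (\<Sum>x\<in>T. card {b. (x, b) \<in> K})"
    if K: "finite K" "fst ` K \<subseteq> T" for K
  proof -
    have "finite {b. (x, b) \<in> K}" for x
      by (rule finite_subset[OF _ finite_imageI[OF K(1), of snd]]) force
    then have "card (SIGMA x:T. {b. (x, b) \<in> K}) = (\<Sum>x\<in>T. card {b. (x, b) \<in> K})"
      using fT by simp
    moreover have "(SIGMA x:T. {b. (x, b) \<in> K}) = K" using K(2) by force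
    ultimately show ?thesis by simp
  qed
  show ?thesis using card_fibres[of G] card_fibres[of H] fin eq by (simp add: T_def)
qed

text \<open>The admissible \<open>n\<close> fill an interval of length
  \<open>c (\<beta> - \<alpha>)\<close>, up to rounding at its two ends.\<close>

lemma card_progression_in_interval:
  fixes c r \<alpha> \<beta> :: real
  assumes c: "c > 0" and le: "\<alpha> \<le> \<beta>"
  defines "A \<equiv> {n::int. (r + of_int n) / c \<in> {\<alpha>..\<beta>}}"
  shows "finite A" "\<bar>real (card A) - c * (\<beta> - \<alpha>)\<bar> \<le> 1"
proof -
  have A: "A = {\<lceil>c * \<alpha> - r\<rceil>..\<lfloor>c * \<beta> - r\<rfloor>}"
    using c by (auto simp: A_def field_simps le_floor_iff ceiling_le_iff)
  then show "finite A" by simp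
  \<comment> \<open>The integer range may be empty, but because
    \<open>\<alpha> \<le> \<beta>\<close> the formula for its size never drops below 0, so no
    truncation occurs.\<close>
  have "c * (\<beta> - \<alpha>) \<ge> 0" using c le by simp
  then have "c * \<beta> \<ge> c * \<alpha>" by (simp add: right_diff_distrib)
  then have "\<lfloor>c * \<beta> - r\<rfloor> - \<lceil>c * \<alpha> - r\<rceil> + 1 \<ge> 0" by linarith
  then have "real (card A) = of_int (\<lfloor>c * \<beta> - r\<rfloor> - \<lceil>c * \<alpha> - r\<rceil> + 1)"
    by (simp add: A)
  then show "\<bar>real (card A) - c * (\<beta> - \<alpha>)\<bar> \<le> 1"
    unfolding right_diff_distrib by linarith
qed

text \<open>Rounding \<open>n p\<close> down costs at most 1 per coordinate, which division by
  \<open>n\<close> makes negligible.\<close>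

lemma int_vec_approximation:
  fixes p :: "real^'n"
  shows "\<exists>Z. (\<forall>n. int_vec (Z n)) \<and> (\<lambda>n. (1 / real n) *\<^sub>R Z n) \<longlonglongrightarrow> p"
proof (intro exI conjI allI)
  define Z :: "nat \<Rightarrow> real^'n" where "Z n = (\<chi> i. of_int \<lfloor>real n * p $ i\<rfloor>)" for n
  fix n show "int_vec (Z n)" by (simp add: int_vec_def Z_def)
  show "(\<lambda>n. (1 / real n) *\<^sub>R Z n) \<longlonglongrightarrow> p"
  proof (rule vec_tendstoI)
    fix i
    have "(\<lambda>n. ((1 / real n) *\<^sub>R Z n) $ i - p $ i) \<longlonglongrightarrow> 0"
    proof (rule Lim_null_comparison)
      show "\<forall>\<^sub>F n in sequentially. norm (((1 / real n) *\<^sub>R Z n) $ i - p $ i) \<le> 1 / real n"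
        using eventually_gt_at_top[of 0]
      proof eventually_elim
        case (elim n)
        have "((1 / real n) *\<^sub>R Z n) $ i - p $ i = (of_int \<lfloor>real n * p $ i\<rfloor> - real n * p $ i) / real n"
          using elim by (simp add: Z_def field_simps)
        moreover have "\<bar>of_int \<lfloor>real n * p $ i\<rfloor> - real n * p $ i\<bar> \<le> 1" by linarith
        ultimately show ?case using elim by (simp add: divide_right_mono)
      qed
      show "(\<lambda>n. 1 / real n) \<longlonglongrightarrow> 0" by (rule lim_1_over_n)
    qed
    then show "(\<lambda>n. ((1 / real n) *\<^sub>R Z n) $ i) \<longlonglongrightarrow> p $ i" by (rule LIM_zero_cancel)
  qed
qed

text \<open>Compactness comes from projecting the closed set of pairs \<open>(s, p)\<close> with
  \<open>v = s p\<close>, convexity from averaging two points of \<open>P\<close> with weights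
  proportional to \<open>u s\<close> and \<open>u' s'\<close>. If no factor is admissible, the
  interval is empty.\<close>

lemma scaling_factors_eq_interval:
  fixes P :: "(real^'n) set" and v :: "real^'n"
  assumes P: "compact P" "convex P"
  obtains \<alpha> \<beta> where "{s \<in> {0..X}. \<exists>p\<in>P. v = s *\<^sub>R p} = {\<alpha>..\<beta>}"
proof -
  let ?I = "{s \<in> {0..X}. \<exists>p\<in>P. v = s *\<^sub>R p}"
  have "continuous_on ({0..X} \<times> P) (\<lambda>x. fst x *\<^sub>R snd x)"
    by (intro continuous_intros)
  moreover have comp: "compact ({0..X} \<times> P)" using P(1) by (intro compact_Times) auto
  ultimately have "closed (({0..X} \<times> P) \<inter> (\<lambda>x. fst x *\<^sub>R snd x) -` {v})"
    by (intro continuous_closed_preimage) (auto intro: compact_imp_closed)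
  then have "compact (({0..X} \<times> P) \<inter> (({0..X} \<times> P) \<inter> (\<lambda>x. fst x *\<^sub>R snd x) -` {v}))"
    by (rule compact_Int_closed[OF comp])
  then have "compact (fst ` (({0..X} \<times> P) \<inter> (({0..X} \<times> P) \<inter> (\<lambda>x. fst x *\<^sub>R snd x) -` {v})))"
    by (intro compact_continuous_image continuous_intros)
  also have "fst ` (({0..X} \<times> P) \<inter> (({0..X} \<times> P) \<inter> (\<lambda>x. fst x *\<^sub>R snd x) -` {v})) = ?I"
    by force
  finally have "compact ?I" .
  moreover have "convex ?I"
  proof (rule convexI)
    fix s s' u u' :: real
    assume s: "s \<in> ?I" "s' \<in> ?I" and u: "0 \<le> u" "0 \<le> u'" "u + u' = 1"
    obtain p p' where p: "p \<in> P" "v = s *\<^sub>R p" "p' \<in> P" "v = s' *\<^sub>R p'" using s by blast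
    have X: "u *\<^sub>R s + u' *\<^sub>R s' \<in> {0..X}"
      using s u by (intro convexD[OF convex_real_interval(5)]) auto
    define T where "T = u * s + u' * s'"
    have us: "u * s \<ge> 0" "u' * s' \<ge> 0" using s u by auto
    have "u *\<^sub>R v + u' *\<^sub>R v = v" using u by (simp flip: scaleR_add_left)
    moreover have "u *\<^sub>R v = (u * s) *\<^sub>R p" by (subst p(2)) simp
    moreover have "u' *\<^sub>R v = (u' * s') *\<^sub>R p'" by (subst p(4)) simp
    ultimately have v: "v = (u * s) *\<^sub>R p + (u' * s') *\<^sub>R p'" by simp
    have "\<exists>q\<in>P. v = T *\<^sub>R q"
    proof (cases "T = 0")
      case True
      then have "u * s = 0" "u' * s' = 0" using us by (simp_all add: T_def add_nonneg_eq_0_iff)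
      then have "v = 0" using v by (simp only: scaleR_zero_left add_0_left)
      then show ?thesis using True p(1) by auto
    next
      case False
      then have "T > 0" using us by (simp add: T_def)
      then have "(u * s / T) *\<^sub>R p + (u' * s' / T) *\<^sub>R p' \<in> P"
        using us p by (intro convexD[OF P(2)]) (auto simp: T_def simp flip: add_divide_distrib)
      moreover have "v = T *\<^sub>R ((u * s / T) *\<^sub>R p + (u' * s' / T) *\<^sub>R p')"
        using v False by (simp add: scaleR_add_right)
      ultimately show ?thesis by blast
    qed
    then show "u *\<^sub>R s + u' *\<^sub>R s' \<in> ?I" using X by (simp add: T_def)
  qed
  ultimately have "\<exists>\<alpha> \<beta>. ?I = {\<alpha>..\<beta>}"
    using connected_compact_interval_1 convex_connected by blast
  then show ?thesis using that by blast
qed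

section \<open>Polytopes spanning a hyperplane through the origin\<close>

text \<open>As \<open>a\<close> vanishes on \<open>P\<close> and \<open>a \<bullet> u = 1\<close>
  for the axis vector \<open>u\<close>, an integer point \<open>z\<close> of
  \<open>s (P + c u)\<close> with \<open>c > 0\<close> determines \<open>s\<close> as
  \<open>(a \<bullet> z) / c\<close>. Each integer point is thus counted at a single
  \<open>s\<close>, so the counts for all \<open>s \<le> X\<close> can be added up.\<close>

lemma separating_translates_linear_hyperplane:
  fixes P :: "(real^'n) set"
  assumes P: "compact P" "convex P" and hull: "affine hull P = {x. a \<bullet> x = 0}" and aj: "a $ j = 1"
    and p0: "p0 \<in> P" "e > 0" "ball p0 e \<inter> affine hull P \<subseteq> P"
    and irr: "\<And>t w. int_vec w \<Longrightarrow> w \<noteq> 0 \<Longrightarrow> t *\<^sub>R w \<notin> P"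
  shows "\<exists>w::real^'n. int_vec w \<and>
           (\<forall>k k' :: nat. k < k' \<longrightarrow>
              (\<exists>s\<ge>0. ehrhart ((\<lambda>x. x + real k *\<^sub>R w) ` P) s
                     \<noteq> ehrhart ((\<lambda>x. x + real k' *\<^sub>R w) ` P) s))"
proof -
  define u where "u = (axis j 1 :: real^'n)"
  have u: "int_vec u" "u $ j = 1" "a \<bullet> u = 1" "u \<noteq> 0"
    using aj int_vec_axis by (auto simp: u_def inner_axis axis_eq_0_iff)
  have bP: "bounded P" using P(1) by (rule compact_imp_bounded)
  have aP: "a \<bullet> p = 0" if "p \<in> P" for p using hull hull_subset[of P affine] that by auto
  have zero: "0 \<notin> P" using irr[OF u(1,4), of 0] by simp
  define \<pi> where "\<pi> x = x - (a \<bullet> x) *\<^sub>R u" for x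
  have a\<pi>: "a \<bullet> \<pi> x = 0" for x by (simp add: \<pi>_def inner_diff_right u)

  obtain Z where Z: "\<And>n. int_vec (Z n)" and Zlim: "(\<lambda>n. (1 / real n) *\<^sub>R Z n) \<longlonglongrightarrow> p0"
    using int_vec_approximation[of p0] by blast
  \<comment> \<open>The projection \<open>\<pi>\<close> fixes \<open>p0\<close> and maps into the
    hyperplane, so the projected approximations eventually lie in \<open>P\<close>.\<close>
  have "(\<lambda>n. \<pi> ((1 / real n) *\<^sub>R Z n)) \<longlonglongrightarrow> \<pi> p0"
    unfolding \<pi>_def by (intro tendsto_intros Zlim)
  moreover have "\<pi> p0 = p0" using aP p0(1) by (simp add: \<pi>_def)
  ultimately have "(\<lambda>n. \<pi> ((1 / real n) *\<^sub>R Z n)) \<longlonglongrightarrow> p0" by simp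
  then have "\<forall>\<^sub>F n in sequentially. \<pi> ((1 / real n) *\<^sub>R Z n) \<in> ball p0 e"
    using p0(2) by (intro topological_tendstoD) auto
  then have "\<forall>\<^sub>F n in sequentially. n > 0 \<and> \<pi> ((1 / real n) *\<^sub>R Z n) \<in> ball p0 e"
    using eventually_gt_at_top[of 0] by eventually_elim auto
  then have "\<exists>n>0. \<pi> ((1 / real n) *\<^sub>R Z n) \<in> ball p0 e"
    by (rule eventually_happens'[OF sequentially_bot])
  then obtain N where N: "N > 0" "\<pi> ((1 / real N) *\<^sub>R Z N) \<in> ball p0 e"
    by blast
  \<comment> \<open>The projection of \<open>y0\<close> stays in \<open>s P\<close> for all \<open>s\<close> in a nondegenerate interval, so that the
    total length of the intervals below is positive.\<close>
  define y0 where "y0 = Z N - (Z N $ j) *\<^sub>R u"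
  have y0: "int_vec y0" "y0 $ j = 0"
    using Z[of N] u by (auto simp: y0_def int_vec_def)
  have "(1 / real N) *\<^sub>R \<pi> y0 = \<pi> ((1 / real N) *\<^sub>R Z N)"
    by (simp add: \<pi>_def y0_def u inner_diff_right algebra_simps)
  with N have N0: "(1 / real N) *\<^sub>R \<pi> y0 \<in> ball p0 e" by simp
  have "((\<lambda>s. (1 / s) *\<^sub>R \<pi> y0) \<longlongrightarrow> (1 / real N) *\<^sub>R \<pi> y0) (at (real N))"
    using N(1) by (intro tendsto_intros) auto
  then have "\<forall>\<^sub>F s in at (real N). (1 / s) *\<^sub>R \<pi> y0 \<in> ball p0 e"
    using N0 by (intro topological_tendstoD) auto
  then obtain d where d: "d > 0"
    "\<And>s. s \<noteq> real N \<Longrightarrow> dist s (real N) < d \<Longrightarrow> (1 / s) *\<^sub>R \<pi> y0 \<in> ball p0 e"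
    unfolding eventually_at by blast
  \<comment> \<open>Half of \<open>d\<close> turns the strict bound on the distance into a closed
    interval of factors.\<close>
  define \<delta> where "\<delta> = d / 2"
  have \<delta>: "\<delta> > 0" using d by (simp add: \<delta>_def)
  have window: "\<exists>p\<in>P. \<pi> y0 = s *\<^sub>R p" if s: "s \<in> {real N..real N + \<delta>}" for s
  proof
    have "(1 / s) *\<^sub>R \<pi> y0 \<in> ball p0 e"
      using N0 d s by (cases "s = real N") (auto simp: dist_real_def \<delta>_def)
    then show "(1 / s) *\<^sub>R \<pi> y0 \<in> P" using p0(3) hull a\<pi> by auto
    show "\<pi> y0 = s *\<^sub>R ((1 / s) *\<^sub>R \<pi> y0)" using s N(1) by simp
  qed

  \<comment> \<open>The cutoff keeps the totals finite and still admits the whole interval found for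
    \<open>y0\<close>.\<close>
  define X where "X = real N + \<delta>"
  define I where "I y = {s \<in> {0..X}. \<exists>p\<in>P. \<pi> y = s *\<^sub>R p}" for y
  have "\<exists>\<alpha> \<beta>. I y = {\<alpha>..\<beta>}" for y
    unfolding I_def by (rule scaling_factors_eq_interval[OF P]) blast
  then obtain \<alpha> \<beta> where I: "\<And>y. I y = {\<alpha> y..\<beta> y}" by metis
  \<comment> \<open>Every integer point differs by an integer multiple of \<open>u\<close> from
    exactly one integer vector with \<open>j\<close>-th coordinate 0; these represent the fibres of
    \<open>\<pi>\<close>.\<close>
  define Y where "Y = {y. int_vec y \<and> y $ j = 0 \<and> I y \<noteq> {}}"
  have y0Y: "{real N..real N + \<delta>} \<subseteq> I y0" "y0 \<in> Y"
  proof -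
    show sub: "{real N..real N + \<delta>} \<subseteq> I y0" using window by (auto simp: I_def X_def)
    show "y0 \<in> Y" using y0 sub \<delta> by (auto simp: Y_def)
  qed
  have finY: "finite Y"
  proof -
    \<comment> \<open>Clearing the \<open>j\<close>-th coordinate inverts \<open>\<pi>\<close> on
      vectors whose \<open>j\<close>-th coordinate is 0, so \<open>Y\<close> lies in a continuous
      image of a compact set.\<close>
    let ?f = "\<lambda>x. fst x *\<^sub>R snd x - ((fst x *\<^sub>R snd x) $ j) *\<^sub>R u"
    have "y \<in> ?f ` ({0..X} \<times> P)" if y: "y \<in> Y" for y
    proof -
      obtain s p where sp: "s \<in> {0..X}" "p \<in> P" "\<pi> y = s *\<^sub>R p" using y by (auto simp: Y_def I_def)
      have "y = \<pi> y - (\<pi> y $ j) *\<^sub>R u" using y by (simp add: \<pi>_def Y_def u)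
      then show ?thesis using sp by (intro image_eqI[of _ _ "(s, p)"]) auto
    qed
    then have "Y \<subseteq> {y. int_vec y \<and> y \<in> ?f ` ({0..X} \<times> P)}" by (auto simp: Y_def)
    moreover have "compact (?f ` ({0..X} \<times> P))"
      by (intro compact_continuous_image continuous_intros compact_Times P compact_Icc)
    then have "finite {y. int_vec y \<and> y \<in> ?f ` ({0..X} \<times> P)}"
      by (intro finite_int_vec_bounded compact_imp_bounded)
    ultimately show ?thesis by (rule finite_subset)
  qed

  \<comment> \<open>\<open>F\<close> parametrises \<open>G\<close> by writing an integer point as \<open>y + n u\<close> with \<open>y $ j = 0\<close>; the dilation
    factor is then forced to be \<open>(a \<bullet> y + n) / c\<close>.\<close>
  define G where "G c = {(s, z). s \<in> {0..X} \<and> int_vec z \<and> (\<exists>p\<in>P. z = s *\<^sub>R (p + c *\<^sub>R u))}" for c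
  define F where "F c = (SIGMA y:Y. {n::int. (a \<bullet> y + of_int n) / c \<in> {\<alpha> y..\<beta> y}})" for c
  have le: "\<alpha> y \<le> \<beta> y" if "y \<in> Y" for y using that by (auto simp: Y_def I)
  have finF: "finite (F c)" if "c > 0" for c
    unfolding F_def using finY that le by (intro finite_SigmaI card_progression_in_interval(1))
  have GF: "bij_betw (\<lambda>(y, n). ((a \<bullet> y + of_int n) / c, y + of_int n *\<^sub>R u)) (F c) (G c)"
    if c: "c > 0" for c
    unfolding bij_betw_def
  proof
    show "inj_on (\<lambda>(y, n). ((a \<bullet> y + of_int n) / c, y + of_int n *\<^sub>R u)) (F c)"
    proof (rule inj_onI, clarify)
      fix y n y' n'
      assume "(y, n) \<in> F c" "(y', n') \<in> F c" and eq: "y + of_int n *\<^sub>R u = y' + of_int n' *\<^sub>R u"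
      then have "y $ j = 0" "y' $ j = 0" by (auto simp: F_def Y_def)
      moreover have "(y + of_int n *\<^sub>R u) $ j = (y' + of_int n' *\<^sub>R u) $ j" using eq by simp
      ultimately have "n = n'" by (simp add: u)
      then show "y = y' \<and> n = n'" using eq by simp
    qed
    show "(\<lambda>(y, n). ((a \<bullet> y + of_int n) / c, y + of_int n *\<^sub>R u)) ` F c = G c"
    proof safe
      fix y n assume yn: "(y, n) \<in> F c"
      define s where "s = (a \<bullet> y + of_int n) / c"
      have y: "y \<in> Y" "s \<in> I y" using yn by (auto simp: F_def I s_def)
      then obtain p where p: "p \<in> P" "\<pi> y = s *\<^sub>R p" and s: "s \<in> {0..X}" by (auto simp: I_def)
      have "s * c = a \<bullet> y + of_int n" using c by (simp add: s_def)
      then have "y + of_int n *\<^sub>R u = s *\<^sub>R (p + c *\<^sub>R u)"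
        by (simp add: scaleR_add_right p(2)[symmetric] \<pi>_def scaleR_add_left)
      moreover have "int_vec (y + of_int n *\<^sub>R u)" using y(1) u(1) by (auto simp: Y_def int_vec_def)
      ultimately show "((a \<bullet> y + of_int n) / c, y + of_int n *\<^sub>R u) \<in> G c"
        using s p(1) by (auto simp: G_def s_def)
    next
      fix s z assume "(s, z) \<in> G c"
      then obtain p where p: "p \<in> P" and z: "z = s *\<^sub>R (p + c *\<^sub>R u)" "int_vec z" and s: "s \<in> {0..X}"
        by (auto simp: G_def)
      obtain n where n: "z $ j = of_int n" using z(2) by (auto simp: int_vec_def elim: Ints_cases)
      define y where "y = z - of_int n *\<^sub>R u"
      have "a \<bullet> z = s * c" using aP[OF p] by (simp add: z inner_add_right u)
      then have ay: "a \<bullet> y + of_int n = s * c" by (simp add: y_def inner_diff_right u)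
      have "\<pi> y = s *\<^sub>R p"
        using ay by (simp add: \<pi>_def y_def z algebra_simps flip: scaleR_add_left)
      then have "s \<in> I y" using s p by (auto simp: I_def)
      moreover have "int_vec y" "y $ j = 0" using z(2) u n by (auto simp: y_def int_vec_def)
      ultimately have "(y, n) \<in> F c" using ay c by (auto simp: F_def Y_def simp flip: I)
      moreover have "(s, z) = ((a \<bullet> y + of_int n) / c, y + of_int n *\<^sub>R u)"
        using ay c by (simp add: y_def)
      ultimately show "(s, z) \<in> (\<lambda>(y, n). ((a \<bullet> y + of_int n) / c, y + of_int n *\<^sub>R u)) ` F c"
        by force
    qed
  qed
  have finG: "finite (G c)" if "c > 0" for c
    using bij_betw_finite[OF GF[OF that]] finF[OF that] by simp
  have cardG: "real (card (G c)) = (\<Sum>y\<in>Y. real (card {n::int. (a \<bullet> y + of_int n) / c \<in> {\<alpha> y..\<beta> y}}))"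
    if c: "c > 0" for c
  proof -
    have "card (G c) = card (F c)" using bij_betw_same_card[OF GF[OF c]] by simp
    also have "\<dots> = (\<Sum>y\<in>Y. card {n::int. (a \<bullet> y + of_int n) / c \<in> {\<alpha> y..\<beta> y}})"
      unfolding F_def using finY c le by (intro card_SigmaI ballI card_progression_in_interval(1))
    finally show ?thesis by simp
  qed
  have card_fibre: "card {z. (s, z) \<in> G c} = (if s \<in> {0..X} then ehrhart ((\<lambda>x. x + c *\<^sub>R u) ` P) s else 0)"
    for s c
    by (auto simp: G_def ehrhart_def image_image intro!: arg_cong[where f=card])

  \<comment> \<open>Each of the two totals compared below has rounding error at most
    \<open>card Y\<close>, while the main term of \<open>y0\<close> alone grows by at least
    \<open>m \<delta>\<close>. The bound also gives \<open>m \<delta> > 1\<close>, which yields a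
    point over \<open>y0\<close> when \<open>k = 0\<close>.\<close>
  obtain m :: nat where m: "real m > (2 * card Y + 1) / \<delta>" using reals_Archimedean2 by blast
  then have m\<delta>: "m * \<delta> > 2 * card Y + 1" using \<delta> by (simp add: field_simps)
  have m0: "m > 0" using m\<delta> by (intro Nat.gr0I) auto
  have "\<exists>s\<ge>0. ehrhart ((\<lambda>x. x + real k *\<^sub>R (real m *\<^sub>R u)) ` P) s
                     \<noteq> ehrhart ((\<lambda>x. x + real k' *\<^sub>R (real m *\<^sub>R u)) ` P) s"
    if kk: "k < k'" for k k' :: nat
  proof (cases "k = 0")
    case True
    \<comment> \<open>Division by \<open>k m\<close> is impossible here, but by \<open>irr\<close>
      the untranslated \<open>P\<close> has count 0 at every positive \<open>s\<close>. One integer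
      point of the other translate therefore suffices.\<close>
    define c where "c = real k' * m"
    have "1 * real m \<le> c" unfolding c_def using kk by (intro mult_right_mono) auto
    then have c: "c > 0" "c * \<delta> \<ge> m * \<delta>" using m0 \<delta> by auto
    let ?A = "{n::int. (a \<bullet> y0 + of_int n) / c \<in> {real N..real N + \<delta>}}"
    have "\<bar>real (card ?A) - c * (real N + \<delta> - real N)\<bar> \<le> 1"
      using c(1) \<delta> by (intro card_progression_in_interval(2)) auto
    then have "real (card ?A) > 0" using c m\<delta> by simp
    then have "?A \<noteq> {}" by (metis card.empty of_nat_0 less_irrefl)
    then obtain n :: int where n: "(a \<bullet> y0 + of_int n) / c \<in> {real N..real N + \<delta>}" by blast
    define s where "s = (a \<bullet> y0 + of_int n) / c"
    have s: "s > 0" using n N(1) by (auto simp: s_def)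
    have "(y0, n) \<in> F c" using y0Y n by (auto simp: F_def simp flip: I)
    then have "(s, y0 + of_int n *\<^sub>R u) \<in> G c"
      using bij_betwE[OF GF[OF c(1)]] by (force simp: s_def)
    then have "ehrhart ((\<lambda>x. x + c *\<^sub>R u) ` P) s \<noteq> 0"
      unfolding ehrhart_translate_eq_0_iff[OF bP] by (auto simp: G_def)
    moreover have "ehrhart ((\<lambda>x. x + real k *\<^sub>R (real m *\<^sub>R u)) ` P) s = 0"
      unfolding ehrhart_translate_eq_0_iff[OF bP]
    proof safe
      fix p assume p: "p \<in> P" "int_vec (s *\<^sub>R (p + real k *\<^sub>R (real m *\<^sub>R u)))"
      then have "(1 / s) *\<^sub>R (s *\<^sub>R p) \<notin> P" using True zero s by (intro irr) auto
      then show False using p(1) s by simp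
    qed
    ultimately show ?thesis using s by (intro exI[of _ s]) (simp add: c_def)
  next
    case False
    define c c' where "c = real k * m" and "c' = real k' * m"
    have c: "c > 0" "c' > 0" using False kk m0 by (auto simp: c_def c'_def)
    have "(real k + 1) * real m \<le> real k' * real m" using kk by (intro mult_right_mono) auto
    then have cc: "c' - c \<ge> m" by (simp add: c_def c'_def algebra_simps)
    show ?thesis
    \<comment> \<open>Equal functions would give equal totals, against the growth of the main terms
      beyond the rounding errors.\<close>
    proof (rule ccontr)
      assume "\<not> ?thesis"
      then have "ehrhart ((\<lambda>x. x + c *\<^sub>R u) ` P) s = ehrhart ((\<lambda>x. x + c' *\<^sub>R u) ` P) s" if "s \<ge> 0" for s
        using that by (auto simp: c_def c'_def)
      then have eq: "card (G c) = card (G c')"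
        using c by (intro card_eq_if_fibres_eq finG) (auto simp: card_fibre)
      have "real (card (G c)) \<le> (\<Sum>y\<in>Y. c * (\<beta> y - \<alpha> y) + 1)"
        unfolding cardG[OF c(1)]
      proof (rule sum_mono)
        fix y assume "y \<in> Y"
        then show "real (card {n::int. (a \<bullet> y + of_int n) / c \<in> {\<alpha> y..\<beta> y}}) \<le> c * (\<beta> y - \<alpha> y) + 1"
          using card_progression_in_interval(2)[OF c(1) le, of y "a \<bullet> y"] by linarith
      qed
      moreover have "real (card (G c')) \<ge> (\<Sum>y\<in>Y. c' * (\<beta> y - \<alpha> y) - 1)"
        unfolding cardG[OF c(2)]
      proof (rule sum_mono)
        fix y assume "y \<in> Y"
        then show "c' * (\<beta> y - \<alpha> y) - 1 \<le> real (card {n::int. (a \<bullet> y + of_int n) / c' \<in> {\<alpha> y..\<beta> y}})"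
          using card_progression_in_interval(2)[OF c(2) le, of y "a \<bullet> y"] by linarith
      qed
      ultimately have "(\<Sum>y\<in>Y. (c' - c) * (\<beta> y - \<alpha> y)) \<le> 2 * card Y"
        using eq by (simp add: sum_subtractf sum.distrib left_diff_distrib)
      moreover have "(c' - c) * (\<beta> y0 - \<alpha> y0) \<le> (\<Sum>y\<in>Y. (c' - c) * (\<beta> y - \<alpha> y))"
        using finY y0Y(2) cc le by (intro member_le_sum) auto
      moreover have "real m * \<delta> \<le> (c' - c) * (\<beta> y0 - \<alpha> y0)"
        using cc \<delta> y0Y(1) by (intro mult_mono) (auto simp: I)
      ultimately show False using m\<delta> by linarith
    qed
  qed
  moreover have "int_vec (real m *\<^sub>R u)" using u(1) by (intro int_vec_scale) auto
  ultimately show ?thesis by blast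
qed

section \<open>Reduction to the two cases\<close>

theorem theorem3:
  fixes P :: "(real^'n) set"
  assumes "polytope P"
    and "aff_dim P = int CARD('n) \<or> aff_dim P = int CARD('n) - 1"
  shows "\<exists>w::real^'n. int_vec w \<and>
           (\<forall>k k' :: nat. k \<noteq> k' \<longrightarrow>
              (\<exists>s\<ge>0. ehrhart ((\<lambda>x. x + real k *\<^sub>R w) ` P) s
                     \<noteq> ehrhart ((\<lambda>x. x + real k' *\<^sub>R w) ` P) s))"
proof -
  have P: "compact P" "convex P" "bounded P"
    using assms(1) polytope_imp_compact polytope_imp_convex polytope_imp_bounded by auto
  \<comment> \<open>The dimension of \<open>P\<close> is then at least 0, whereas the empty set has
    dimension -1.\<close>
  have "CARD('n) > 0" by simp
  then have "P \<noteq> {}" using assms(2) by auto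
  then have "rel_interior P \<noteq> {}" using P(2) by (simp add: rel_interior_eq_empty)
  then obtain p0 e where p0: "p0 \<in> P" "e > 0" "ball p0 e \<inter> affine hull P \<subseteq> P"
    by (auto simp: mem_rel_interior_ball)
  have "\<exists>w::real^'n. int_vec w \<and>
           (\<forall>k k' :: nat. k < k' \<longrightarrow>
              (\<exists>s\<ge>0. ehrhart ((\<lambda>x. x + real k *\<^sub>R w) ` P) s
                     \<noteq> ehrhart ((\<lambda>x. x + real k' *\<^sub>R w) ` P) s))"
  proof (cases "\<exists>t w. int_vec w \<and> w \<noteq> 0 \<and> t *\<^sub>R w \<in> P")
    case True
    then show ?thesis using separating_translates_rational_direction[OF P(3)] by blast
  next
    case False
    then have irr: "int_vec w \<Longrightarrow> w \<noteq> 0 \<Longrightarrow> t *\<^sub>R w \<notin> P" for t and w :: "real^'n" by blast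
    have zero: "0 \<notin> P"
      using irr[of "axis undefined 1" 0] int_vec_axis by (auto simp: axis_eq_0_iff)
    have irr': "int_vec w \<Longrightarrow> t *\<^sub>R w \<notin> P" for t and w :: "real^'n"
      using irr[of w t] zero by (cases "w = 0") auto
    obtain Z where Z: "\<And>n. int_vec (Z n)" and Zlim: "(\<lambda>n. (1 / real n) *\<^sub>R Z n) \<longlonglongrightarrow> p0"
      using int_vec_approximation[of p0] by blast
    \<comment> \<open>In full dimension a ball around \<open>p0\<close> lies in \<open>P\<close> and
      contains a rational point.\<close>
    have hull_ne: "affine hull P \<noteq> UNIV"
    proof
      assume hull: "affine hull P = UNIV"
      have "\<forall>\<^sub>F n in sequentially. (1 / real n) *\<^sub>R Z n \<in> ball p0 e"
        using p0(2) by (intro topological_tendstoD[OF Zlim]) auto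
      then have "\<exists>n. (1 / real n) *\<^sub>R Z n \<in> ball p0 e" by (rule eventually_happens'[OF sequentially_bot])
      then obtain n where "(1 / real n) *\<^sub>R Z n \<in> ball p0 e" by blast
      then have "(1 / real n) *\<^sub>R Z n \<in> P" using p0(3) hull by auto
      then show False using irr'[OF Z] by contradiction
    qed
    then have "aff_dim P \<noteq> int CARD('n)" using aff_dim_eq_full[of P] by simp
    with assms(2) have "aff_dim P = int (DIM(real^'n) - 1)" by (simp add: of_nat_diff Suc_leI)
    then have "\<exists>a b. a \<noteq> 0 \<and> affine hull P = {x. a \<bullet> x = b}"
      by (simp only: aff_dim_eq_hyperplane)
    then obtain a b where "a \<noteq> 0" and hull: "affine hull P = {x. a \<bullet> x = b}" by blast
    \<comment> \<open>If the hyperplane missed the origin, rational points near \<open>p0\<close>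
      could be rescaled onto it while staying near \<open>p0\<close>, which would put a multiple of
      an integer vector into \<open>P\<close>.\<close>
    have "b = 0"
    proof (rule ccontr)
      assume b: "b \<noteq> 0"
      define q where "q n = (1 / real n) *\<^sub>R Z n" for n
      have ap0: "a \<bullet> p0 = b" using hull hull_subset[of P affine] p0(1) by auto
      have q: "q \<longlonglongrightarrow> p0" unfolding q_def by (rule Zlim)
      have "(\<lambda>n. (b / (a \<bullet> q n)) *\<^sub>R q n) \<longlonglongrightarrow> (b / (a \<bullet> p0)) *\<^sub>R p0"
        using b ap0 by (intro tendsto_intros q) auto
      then have lim: "(\<lambda>n. (b / (a \<bullet> q n)) *\<^sub>R q n) \<longlonglongrightarrow> p0" using b ap0 by simp
      have "\<forall>\<^sub>F n in sequentially. (b / (a \<bullet> q n)) *\<^sub>R q n \<in> ball p0 e"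
        using p0(2) by (intro topological_tendstoD[OF lim]) auto
      moreover have "\<forall>\<^sub>F n in sequentially. a \<bullet> q n \<noteq> 0"
        using b ap0 by (intro tendsto_imp_eventually_ne[OF tendsto_inner[OF tendsto_const q]]) auto
      ultimately have "\<forall>\<^sub>F n in sequentially. (b / (a \<bullet> q n)) *\<^sub>R q n \<in> P"
      proof eventually_elim
        case (elim n)
        then show ?case using p0(3) hull by auto
      qed
      then have "\<exists>n. (b / (a \<bullet> q n)) *\<^sub>R q n \<in> P" by (rule eventually_happens'[OF sequentially_bot])
      then obtain n where "(b / (a \<bullet> q n)) *\<^sub>R q n \<in> P" by blast
      then show False using irr'[OF Z] by (auto simp: q_def)
    qed
    obtain j where j: "a $ j \<noteq> 0" using \<open>a \<noteq> 0\<close> by (auto simp: vec_eq_iff)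
    have "affine hull P = {x. ((1 / a $ j) *\<^sub>R a) \<bullet> x = 0}" using hull \<open>b = 0\<close> j by simp
    moreover have "((1 / a $ j) *\<^sub>R a) $ j = 1" using j by simp
    ultimately show ?thesis using P(1,2) p0 irr by (intro separating_translates_linear_hyperplane)
  qed
  then obtain w :: "real^'n" where w: "int_vec w" and sep: "\<And>k k' :: nat. k < k' \<Longrightarrow>
    \<exists>s\<ge>0. ehrhart ((\<lambda>x. x + real k *\<^sub>R w) ` P) s \<noteq> ehrhart ((\<lambda>x. x + real k' *\<^sub>R w) ` P) s"
    by blast
  have "\<exists>s\<ge>0. ehrhart ((\<lambda>x. x + real k *\<^sub>R w) ` P) s \<noteq> ehrhart ((\<lambda>x. x + real k' *\<^sub>R w) ` P) s"
    if "k \<noteq> k'" for k k' :: nat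
    using that sep[of k k'] sep[of k' k] by (metis nat_neq_iff)
  with w show ?thesis by blast
qed

end
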